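(* Let $n$ be a positive integer, let $a,b$ be distinct odd primes and let $c,d$ be distinct odd primes. Put $A = 2^n ab$ and $B = 2^n cd$, and suppose that $(A,B)$ is an amicable pair. Then \begin{align*} a+b &= 2^{-n}\bigl(B-(\varphi(A)+\varphi(B))\bigr)+1,\\ c+d &= 2^{-n}\bigl(A-(\varphi(A)+\varphi(B))\bigr)+1. \end{align*}
   Context: For a positive integer $m$, $\sigma(m)$ denotes the sum of all positive divisors of $m$, and $\varphi$ denotes Euler's totient function. Two positive integers $A$ and $B$ form an amicable pair if $\sigma(A)=\sigma(B)=A+B$ (equivalently, each is the sum of the proper divisors of the other). *)

theory Defs
  imports Complex_Main "HOL-Number_Theory.Totient"
begin

text \<open>For \<open>m = 0\<close> the index set is infinite and the sum is \<open>0\<close>; the notion is only meant for \<open>m > 0\<close>.\<close>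
definition divisor_sum :: "nat \<Rightarrow> nat" where
  "divisor_sum m = (\<Sum>d | d dvd m. d)"

definition amicable_pair :: "nat \<Rightarrow> nat \<Rightarrow> bool" where
  "amicable_pair A B \<longleftrightarrow>
     A > 0 \<and> B > 0 \<and> divisor_sum A = A + B \<and> divisor_sum B = A + B"

end

theory Submission
  imports Defs
begin

text \<open>
  Both claims are rearrangements of the equality \<open>\<sigma>(A) = \<sigma>(B)\<close>. Each odd prime \<open>p\<close> among the
  factors of \<open>A\<close> or \<open>B\<close> occurs there once and so contributes a factor \<open>p + 1\<close> to \<open>\<sigma>\<close>; with the
  common factor \<open>\<sigma>(2 ^ n)\<close> cancelled, the equality reads
  \<open>(a + 1) (b + 1) = (c + 1) (d + 1)\<close>, that is, \<open>ab + (a + b) = cd + (c + d)\<close>. On the other hand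
  \<open>2 \<phi>(A) = 2 ^ n (a - 1) (b - 1)\<close>, and similarly for \<open>B\<close>. Expanding these products and dividing
  by \<open>2 ^ n\<close>, both claims become linear in \<open>ab\<close>, \<open>a + b\<close>, \<open>cd\<close>, \<open>c + d\<close> and equivalent to the
  equation above.
\<close>

text \<open>
  The divisors of \<open>m p\<close> not divisible by \<open>p\<close> are the divisors of \<open>m\<close>; the others are
  \<open>p\<close> times a divisor of \<open>m\<close>.
\<close>
lemma divisor_sum_mult_prime:
  assumes "prime p" and "\<not> p dvd m"
  shows "divisor_sum (m * p) = divisor_sum m * (p + 1)"
proof -
  have "m \<noteq> 0" using assms(2) by (metis dvd_0_right)
  have "p > 0" using assms(1) by (rule prime_gt_0_nat)
  let ?D = "{d. d dvd m}"
  have fin: "finite ?D"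
    using \<open>m \<noteq> 0\<close> by simp
  have "{d. d dvd m * p} = ?D \<union> (*) p ` ?D"
  proof (intro equalityI subsetI)
    fix d assume "d \<in> {d. d dvd m * p}"
    then have d: "d dvd m * p" by simp
    show "d \<in> ?D \<union> (*) p ` ?D"
    proof (cases "p dvd d")
      case True
      then obtain e where "d = p * e" ..
      with d \<open>p > 0\<close> show ?thesis by (auto simp: mult.commute)
    next
      case False
      with \<open>prime p\<close> have "coprime d p"
        using prime_imp_coprime coprime_commute by blast
      with d show ?thesis by (simp add: coprime_dvd_mult_left_iff)
    qed
  qed (auto simp: mult.commute)
  moreover have "?D \<inter> (*) p ` ?D = {}"
    using assms(2) by (auto dest: dvd_mult_left)
  ultimately have "divisor_sum (m * p) = divisor_sum m + (\<Sum>d\<in>(*) p ` ?D. d)"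
    using fin by (simp add: divisor_sum_def sum.union_disjoint)
  also have "(\<Sum>d\<in>(*) p ` ?D. d) = p * divisor_sum m"
    using \<open>p > 0\<close> by (simp add: divisor_sum_def sum.reindex inj_on_def sum_distrib_left)
  finally show ?thesis by (simp add: algebra_simps)
qed

lemma divisor_sum_pos:
  assumes "m > 0"
  shows "divisor_sum m > 0"
  unfolding divisor_sum_def
  using assms by (intro sum_pos2[of _ m]) auto

lemma odd_prime_not_dvd_power_2:
  fixes p :: nat
  assumes "prime p" and "odd p"
  shows "\<not> p dvd 2 ^ n"
  using assms by (metis even_numeral prime_dvd_power primes_dvd_imp_eq two_is_prime_nat)

lemma odd_prime_not_dvd_power_2_mult:
  fixes p q :: nat
  assumes "prime p" and "prime q" and "odd q" and "p \<noteq> q"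
  shows "\<not> q dvd 2 ^ n * p"
  using assms odd_prime_not_dvd_power_2 by (metis prime_dvd_mult_iff primes_dvd_imp_eq)

lemma divisor_sum_power_2_mult_primes:
  assumes "prime p" and "odd p" and "prime q" and "odd q" and "p \<noteq> q"
  shows "divisor_sum (2 ^ n * p * q) = divisor_sum (2 ^ n) * ((p + 1) * (q + 1))"
  using assms
  by (metis divisor_sum_mult_prime odd_prime_not_dvd_power_2
      odd_prime_not_dvd_power_2_mult mult.assoc)

text \<open>
  The factor \<open>2\<close> clears the denominator in \<open>\<phi>(2 ^ n) = 2 ^ n / 2\<close>; that value needs \<open>n > 0\<close>,
  since \<open>\<phi>(1) = 1\<close>.
\<close>
lemma totient_power_2_mult_primes:
  assumes "n > 0" and "prime p" and "odd p" and "prime q" and "odd q" and "p \<noteq> q"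
  shows "2 * real (totient (2 ^ n * p * q)) = 2 ^ n * ((real p - 1) * (real q - 1))"
proof -
  have "coprime (2 ^ n) p" and "coprime (2 ^ n * p) q"
    using assms odd_prime_not_dvd_power_2 odd_prime_not_dvd_power_2_mult
      prime_imp_coprime coprime_commute by blast+
  then have "totient (2 ^ n * p * q) = totient (2 ^ n) * (p - 1) * (q - 1)"
    using assms by (simp add: totient_mult_coprime totient_prime)
  moreover have "2 * totient (2 ^ n) = 2 ^ n"
    using \<open>n > 0\<close> by (cases n) (simp_all add: totient_prime_power_Suc del: power_Suc, simp)
  ultimately have "2 * totient (2 ^ n * p * q) = 2 ^ n * ((p - 1) * (q - 1))"
    by (metis mult.assoc)
  then have "real (2 * totient (2 ^ n * p * q)) = real (2 ^ n * ((p - 1) * (q - 1)))"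
    by (rule arg_cong)
  with prime_ge_1_nat[OF \<open>prime p\<close>] prime_ge_1_nat[OF \<open>prime q\<close>] show ?thesis
    by (simp add: of_nat_diff)
qed

theorem theorem2p1:
  fixes n a b c d A B :: nat
  assumes "n > 0"
    and "prime a" and "odd a" and "prime b" and "odd b" and "a \<noteq> b"
    and "prime c" and "odd c" and "prime d" and "odd d" and "c \<noteq> d"
    and "A = 2 ^ n * a * b" and "B = 2 ^ n * c * d"
    and "amicable_pair A B"
  shows "real (a + b) =
           2 powi (- int n) * (real B - (real (totient A) + real (totient B))) + 1 \<and>
         real (c + d) =
           2 powi (- int n) * (real A - (real (totient A) + real (totient B))) + 1"
proof -
  have "divisor_sum A = divisor_sum B"
    using assms(14) by (simp add: amicable_pair_def)
  then have "divisor_sum (2 ^ n) * ((a + 1) * (b + 1)) = divisor_sum (2 ^ n) * ((c + 1) * (d + 1))"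
    using assms(2-13) by (metis divisor_sum_power_2_mult_primes)
  with divisor_sum_pos[of "2 ^ n"] have "(a + 1) * (b + 1) = (c + 1) * (d + 1)"
    by (metis mult_cancel_left less_numeral_extra(3) zero_less_power pos2)
  then have "real ((a + 1) * (b + 1)) = real ((c + 1) * (d + 1))"
    by (rule arg_cong)
  then have \<sigma>: "real a * b + (real a + b) = real c * d + (real c + d)"
    by (simp add: algebra_simps)
  define N :: real where "N = 2 ^ n"
  have N: "N \<noteq> 0" and powi: "2 powi (- int n) = 1 / N"
    by (simp_all add: N_def power_int_minus field_simps)
  have \<phi>: "real (totient A) = N * ((real a - 1) * (real b - 1)) / 2"
          "real (totient B) = N * ((real c - 1) * (real d - 1)) / 2"
    using totient_power_2_mult_primes[of n a b] totient_power_2_mult_primes[of n c d] assms(1-13)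
    by (simp_all add: N_def)
  have AB: "real A = N * (real a * b)" "real B = N * (real c * d)"
    using assms(12,13) by (simp_all add: N_def)
  have cancel: "1 / N * (N * x - (N * y / 2 + N * z / 2)) = x - (y + z) / 2" for x y z
    using N by (simp add: field_simps)
  show ?thesis
    unfolding powi \<phi> AB cancel using \<sigma> by (simp add: algebra_simps) argo
qed

end
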